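(* Let $d$ be fixed, $0<c<1$, and $\varepsilon=\varepsilon_n>0$ be either a fixed constant or a sequence with $\varepsilon_n\to 0$ and $\varepsilon_n\log n\to\infty$. Then the proportion of graphs in $\mathcal{G}_{d,c}(n)$ having more than $\varepsilon n$ bad nodes tends to $0$ as $n\to\infty$.
   Context: $T_{\max}=\binom{d}{2}\frac{n}{3}$. $\mathcal{G}_{d,c}(n)$ is the set of $d$-regular graphs on $n$ labeled nodes containing at least $c\cdot T_{\max}$ triangles. A node is bad if it is incident to at least one triangle but is not contained in any clique on $d+1$ nodes. *)

theory Defs
  imports Complex_Main
begin

definition graphs :: "nat \<Rightarrow> nat set set set" where
  "graphs n = Pow {e. e \<subseteq> {0..<n} \<and> card e = 2}"

definition degree :: "nat set set \<Rightarrow> nat \<Rightarrow> nat" where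
  "degree E v = card {e \<in> E. v \<in> e}"

definition regular :: "nat \<Rightarrow> nat \<Rightarrow> nat set set \<Rightarrow> bool" where
  "regular d n E \<longleftrightarrow> (\<forall>v<n. degree E v = d)"

definition is_clique :: "nat \<Rightarrow> nat set set \<Rightarrow> nat set \<Rightarrow> bool" where
  "is_clique n E K \<longleftrightarrow> K \<subseteq> {0..<n} \<and> (\<forall>u\<in>K. \<forall>v\<in>K. u \<noteq> v \<longrightarrow> {u, v} \<in> E)"

definition triangles :: "nat \<Rightarrow> nat set set \<Rightarrow> nat set set" where
  "triangles n E = {t. is_clique n E t \<and> card t = 3}"

definition T_max :: "nat \<Rightarrow> nat \<Rightarrow> real" where
  "T_max d n = real (d choose 2) * real n / 3"

definition G_dc :: "nat \<Rightarrow> real \<Rightarrow> nat \<Rightarrow> nat set set set" where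
  "G_dc d c n = {E \<in> graphs n. regular d n E \<and> real (card (triangles n E)) \<ge> c * T_max d n}"

definition bad_nodes :: "nat \<Rightarrow> nat \<Rightarrow> nat set set \<Rightarrow> nat set" where
  "bad_nodes d n E = {v \<in> {0..<n}. (\<exists>t \<in> triangles n E. v \<in> t) \<and>
      \<not> (\<exists>K. is_clique n E K \<and> card K = d + 1 \<and> v \<in> K)}"

end

theory Submission
  imports Defs "HOL-Combinatorics.Permutations" "HOL-Library.FuncSet"
begin

text \<open>
  Fix an order of the vertices and delete from a \<open>d\<close>-regular graph every edge \<open>bc\<close> that lies in a triangle
  \<open>abc\<close> with \<open>a\<close> before \<open>b\<close> and \<open>c\<close>. The graph can be recovered from the remaining edges and \<open>O(n)\<close>
  further bits, so up to a factor \<open>exp (O(n))\<close> every deleted edge saves a factor \<open>n\<close> in the number of graphs.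
  For a random order an edge with \<open>k\<close> common neighbours is deleted with probability
  \<open>k / (k + 2) \<ge> k / (d + 1)\<close>, with equality only for \<open>k = 0\<close> and \<open>k = d - 1\<close>. The values \<open>k\<close> sum
  to three times the number of triangles, so at least \<open>3 c T\<^sub>m\<^sub>a\<^sub>x / (d + 1)\<close> edges are deleted on average, and
  since every bad node is incident to an edge with \<open>0 < k < d - 1\<close>, having \<open>\<epsilon> n\<close> bad nodes saves a
  further \<open>\<Omega>(\<epsilon> n)\<close> edges. Conversely, taking about \<open>c n / (d + 1)\<close> disjoint cliques and an arbitrary
  regular graph on the other vertices shows that the bound without this extra saving is attained
  up to a factor \<open>exp (O(n))\<close>. So the proportion is at most \<open>exp (O(n) - \<Omega>(\<epsilon> n ln n))\<close>.
\<close>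

subsection \<open>Encoding a graph relative to a vertex order\<close>

definition nbrs :: "nat set set \<Rightarrow> nat \<Rightarrow> nat set" where
  "nbrs E v = {u. {u, v} \<in> E}"

definition common :: "nat set set \<Rightarrow> nat set \<Rightarrow> nat set" where
  "common E e = {a. \<forall>x\<in>e. {a, x} \<in> E}"

text \<open>With the vertices ordered by \<open>p\<close>, the edges outside \<open>rest p E\<close> are those lying in a triangle
  whose third vertex comes before both of their ends. Such edges cost only \<open>O(n)\<close> bits in total:
  processing the vertices in the order \<open>p\<close>, all edges from \<open>a\<close> to later vertices are known when \<open>a\<close>
  is reached, and \<open>code p E a\<close> tells which pairs of later neighbours of \<open>a\<close> are adjacent.\<close>

definition rest :: "(nat \<Rightarrow> nat) \<Rightarrow> nat set set \<Rightarrow> nat set set" where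
  "rest p E = {e \<in> E. \<forall>a\<in>common E e. \<exists>x\<in>e. p x < p a}"

definition later :: "(nat \<Rightarrow> nat) \<Rightarrow> nat set set \<Rightarrow> nat \<Rightarrow> nat set" where
  "later p E a = {b \<in> nbrs E a. p a < p b}"

text \<open>Ranks within a set of at most \<open>d\<close> later neighbours are below
  \<open>d\<close>, so the number of possible codes at a vertex depends on \<open>d\<close>
  only.\<close>

definition rank :: "nat set \<Rightarrow> nat \<Rightarrow> nat" where
  "rank A x = card {y \<in> A. y < x}"

definition code :: "(nat \<Rightarrow> nat) \<Rightarrow> nat set set \<Rightarrow> nat \<Rightarrow> (nat \<times> nat) set" where
  "code p E a = map_prod (rank (later p E a)) (rank (later p E a)) `
     {(b, c). b \<in> later p E a \<and> c \<in> later p E a \<and> {b, c} \<in> E}"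

section \<open>Edges, neighbourhoods and decoding\<close>

lemma graph_edge:
  assumes "E \<in> graphs n" "e \<in> E"
  shows "e \<subseteq> {0..<n}" "card e = 2" "finite e"
  using assms by (auto simp: graphs_def intro: finite_subset)

lemma graph_edgeE:
  assumes "E \<in> graphs n" "e \<in> E"
  obtains a b where "e = {a, b}" "a \<noteq> b" "a < n" "b < n"
proof -
  obtain a b where "e = {a, b}" "a \<noteq> b"
    using graph_edge(2)[OF assms] by (auto simp: card_2_iff)
  with graph_edge(1)[OF assms] show ?thesis
    using that by auto
qed

lemma graph_pair:
  assumes "E \<in> graphs n" "{a, b} \<in> E"
  shows "a \<noteq> b" "a < n" "b < n"
  using graph_edge[OF assms] by (auto simp: card_2_iff doubleton_eq_iff)

lemma finite_graph: "E \<in> graphs n \<Longrightarrow> finite E"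
  by (auto simp: graphs_def intro: finite_subset[where B = "Pow {0..<n}"])

lemma finite_graphs: "finite (graphs n)"
  unfolding graphs_def
  by (intro finite_Pow_iff[THEN iffD2]) (rule finite_subset[where B = "Pow {0..<n}"], auto)

lemma nbrs_subset: "E \<in> graphs n \<Longrightarrow> nbrs E v \<subseteq> {0..<n} - {v}"
  by (auto simp: nbrs_def dest: graph_pair)

lemma finite_nbrs: "E \<in> graphs n \<Longrightarrow> finite (nbrs E v)"
  by (meson finite_Diff finite_atLeastLessThan finite_subset nbrs_subset)

lemma degree_eq_card_nbrs:
  assumes "E \<in> graphs n"
  shows "degree E v = card (nbrs E v)"
proof -
  have "bij_betw (\<lambda>u. {u, v}) (nbrs E v) {e \<in> E. v \<in> e}"
    unfolding bij_betw_def
  proof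
    show "inj_on (\<lambda>u. {u, v}) (nbrs E v)"
      by (auto simp: inj_on_def doubleton_eq_iff)
    show "(\<lambda>u. {u, v}) ` nbrs E v = {e \<in> E. v \<in> e}"
    proof (intro equalityI subsetI)
      fix e assume e: "e \<in> {e \<in> E. v \<in> e}"
      then obtain a b where "e = {a, b}" using graph_edgeE[OF assms] by blast
      with e show "e \<in> (\<lambda>u. {u, v}) ` nbrs E v"
        by (auto simp: nbrs_def insert_commute)
    qed (auto simp: nbrs_def)
  qed
  then show ?thesis by (simp add: degree_def bij_betw_same_card)
qed

lemma rank_less:
  assumes "finite A" "x \<in> A"
  shows "rank A x < card A"
  unfolding rank_def using assms by (intro psubset_card_mono) auto

lemma inj_on_rank:
  assumes "finite A"
  shows "inj_on (rank A) A"
proof -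
  have "rank A x < rank A y" if "x \<in> A" "y \<in> A" "x < y" for x y
    unfolding rank_def using assms that by (intro psubset_card_mono) auto
  then show ?thesis
    by (intro linorder_inj_onI) (auto simp: order_less_imp_not_eq)
qed

text \<open>Decoding step. An edge from \<open>a\<close> to a later \<open>b\<close> that is missing
  from \<open>rest p E\<close> has a common neighbour \<open>v\<close> before both ends. The later
  neighbours of \<open>v\<close> are already known, and the code at \<open>v\<close> tells whether
  \<open>a\<close> and \<open>b\<close> are adjacent.\<close>

lemma later_subset:
  assumes "E \<in> graphs n" "E' \<in> graphs n" "inj_on p {0..<n}"
    and rest: "rest p E = rest p E'"
    and code: "\<And>v. v < n \<Longrightarrow> code p E v = code p E' v"
    and before: "\<And>v. v < n \<Longrightarrow> p v < p a \<Longrightarrow> later p E v = later p E' v"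
  shows "later p E a \<subseteq> later p E' a"
proof
  fix b assume b: "b \<in> later p E a"
  then have ab: "{a, b} \<in> E" "p a < p b"
    by (auto simp: later_def nbrs_def insert_commute)
  have "{a, b} \<in> E'"
  proof (cases "{a, b} \<in> rest p E")
    case True
    then show ?thesis unfolding rest by (simp add: rest_def)
  next
    case False
    then obtain v where v: "{v, a} \<in> E" "{v, b} \<in> E" "p v \<le> p a"
      using ab by (fastforce simp: rest_def common_def not_less)
    have vn: "v < n" "a < n" "v \<noteq> a"
      using graph_pair[OF assms(1) v(1)] by auto
    with v(3) assms(3) have pv: "p v < p a"
      by (metis atLeastLessThan_iff inj_onD le0 le_neq_implies_less)
    let ?L = "later p E' v" and ?r = "rank (later p E' v)"
    have L: "later p E v = ?L"
      using before vn pv by blast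
    have abL: "a \<in> ?L" "b \<in> ?L"
      unfolding L[symmetric] using v ab pv by (auto simp: later_def nbrs_def insert_commute)
    have "(?r a, ?r b) \<in> code p E v"
      using ab abL unfolding code_def L by force
    then have "(?r a, ?r b) \<in> code p E' v"
      using code vn by simp
    then obtain x y where xy: "x \<in> ?L" "y \<in> ?L" "{x, y} \<in> E'" "?r a = ?r x" "?r b = ?r y"
      unfolding code_def by auto
    have "inj_on ?r ?L"
      using finite_nbrs[OF assms(2)] by (intro inj_on_rank) (simp add: later_def)
    with xy abL show ?thesis by (metis inj_onD)
  qed
  with ab show "b \<in> later p E' a"
    by (simp add: later_def nbrs_def insert_commute)
qed

text \<open>Induction along the order \<open>p\<close> recovers all sets \<open>later\<close>, and
  every edge is seen from its earlier end.\<close>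

lemma graph_eqI:
  assumes "E \<in> graphs n" "E' \<in> graphs n" "inj_on p {0..<n}"
    and "rest p E = rest p E'"
    and "\<And>v. v < n \<Longrightarrow> code p E v = code p E' v"
  shows "E = E'"
proof -
  have later: "later p E a = later p E' a" for a
  proof (induction "p a" arbitrary: a rule: less_induct)
    case less
    show ?case
      using later_subset[of E n E' p a] later_subset[of E' n E p a] assms less by auto
  qed
  have sub: "F \<subseteq> F'" if F: "F \<in> graphs n" and l: "\<And>a. later p F a = later p F' a" for F F'
  proof
    fix e assume "e \<in> F"
    then obtain a b where e: "e = {a, b}" "a \<noteq> b" "a < n" "b < n"
      using graph_edgeE F by blast
    then have "p a \<noteq> p b" using assms(3) by (auto simp: inj_on_def)
    then consider "b \<in> later p F a" | "a \<in> later p F b"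
      using e \<open>e \<in> F\<close> by (force simp: later_def nbrs_def insert_commute)
    then show "e \<in> F'"
      unfolding l by cases (auto simp: e later_def nbrs_def insert_commute)
  qed
  show ?thesis using sub[of E E'] sub[of E' E] assms later by auto
qed

lemma code_subset:
  assumes "E \<in> graphs n" "regular d n E" "a < n"
  shows "code p E a \<subseteq> {0..<d} \<times> {0..<d}"
proof -
  have "card (later p E a) \<le> d"
    using assms card_mono[OF finite_nbrs[OF assms(1)], of "later p E a" a]
    by (auto simp: regular_def degree_eq_card_nbrs later_def)
  moreover have "finite (later p E a)"
    using finite_nbrs[OF assms(1)] by (simp add: later_def)
  ultimately have "rank (later p E a) x < d" if "x \<in> later p E a" for x
    using rank_less that by (meson less_le_trans)
  then show ?thesis by (auto simp: code_def)
qed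

lemma sum_Pow_power:
  fixes x :: real
  assumes "finite A"
  shows "(\<Sum>F\<in>Pow A. x ^ card F) = (1 + x) ^ card A"
  using prod_add[OF assms, of "\<lambda>_. x" "\<lambda>_. 1"] by (simp add: add.commute)

text \<open>Weighting each graph by \<open>n\<close> to the power \<open>- card (rest p E)\<close> turns the sum over the
  possible values of \<open>rest p E\<close> into a binomial expansion.\<close>

lemma sum_rest_le:
  assumes p: "inj_on p {0..<n}" and "n > 0"
  shows "(\<Sum>E | E \<in> graphs n \<and> regular d n E. (1 / real n) ^ card (rest p E))
           \<le> (2 ^ (d * d) * exp 1) ^ n"
proof -
  define R where "R = {E. E \<in> graphs n \<and> regular d n E}"
  define P where "P = {e. e \<subseteq> {0..<n} \<and> card e = 2}"
  define C where "C = {0..<n} \<rightarrow>\<^sub>E Pow ({0..<d} \<times> {0..<d})"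
  define \<Phi> where "\<Phi> E = (rest p E, restrict (code p E) {0..<n})" for E
  have finP: "finite P" unfolding P_def by (rule finite_subset[where B = "Pow {0..<n}"]) auto
  have finC: "finite C" unfolding C_def by (intro finite_PiE) auto
  have inj: "inj_on \<Phi> R"
  proof (rule inj_onI)
    fix E E' assume "E \<in> R" "E' \<in> R" and eq: "\<Phi> E = \<Phi> E'"
    moreover have "code p E v = code p E' v" if "v < n" for v
      using eq that by (auto simp: \<Phi>_def dest!: fun_cong[of _ _ v])
    ultimately show "E = E'"
      using graph_eqI[OF _ _ p] by (auto simp: R_def \<Phi>_def)
  qed
  have img: "\<Phi> ` R \<subseteq> Pow P \<times> C"
  proof (rule image_subsetI)
    fix E assume E: "E \<in> R"
    then have "rest p E \<in> Pow P"
      by (auto simp: R_def P_def rest_def graphs_def)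
    moreover have "restrict (code p E) {0..<n} \<in> C"
      unfolding C_def using E by (auto simp: R_def dest: code_subset[THEN subsetD])
    ultimately show "\<Phi> E \<in> Pow P \<times> C"
      by (simp add: \<Phi>_def)
  qed
  have "(\<Sum>E\<in>R. (1 / real n) ^ card (rest p E)) = (\<Sum>z\<in>\<Phi> ` R. (1 / real n) ^ card (fst z))"
    by (subst sum.reindex[OF inj]) (simp add: \<Phi>_def)
  also have "\<dots> \<le> (\<Sum>z\<in>Pow P \<times> C. (1 / real n) ^ card (fst z))"
    using img finP finC by (intro sum_mono2) auto
  also have "\<dots> = (\<Sum>F\<in>Pow P. \<Sum>g\<in>C. (1 / real n) ^ card F)"
    by (subst sum.cartesian_product) (simp add: split_beta)
  also have "\<dots> = real (card C) * (1 + 1 / real n) ^ card P"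
    by (simp add: sum_Pow_power[OF finP, symmetric] sum_distrib_left)
  also have "card C = (2 ^ (d * d)) ^ n"
    by (simp add: C_def card_PiE card_Pow card_cartesian_product)
  \<comment> \<open>With weight \<open>1 / n\<close> per edge, even the crude count of
    \<open>n * n\<close> pairs keeps this factor at most \<open>exp n\<close>.\<close>
  also have "(1 + 1 / real n) ^ card P \<le> (1 + 1 / real n) ^ (n * n)"
  proof (rule power_increasing)
    have "card P = n choose 2" unfolding P_def by (subst n_subsets) auto
    moreover have "n * (n - 1) div 2 \<le> n * n"
      by (rule order_trans[OF div_le_dividend]) simp
    ultimately show "card P \<le> n * n" by (simp add: choose_two)
  qed simp
  also have "(1 + 1 / real n) ^ (n * n) \<le> exp (1 / real n) ^ (n * n)"
    by (intro power_mono exp_ge_add_one_self) auto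
  also have "\<dots> = exp 1 ^ n"
    using \<open>n > 0\<close> by (simp flip: exp_of_nat_mult power_mult)
  finally show ?thesis
    by (simp add: R_def power_mult_distrib mult_left_mono)
qed

subsection \<open>Averaging over the vertex orders\<close>

text \<open>Composing with a transposition of two elements of \<open>A\<close> exchanges the events
  that one or the other is the \<open>p\<close>-least element of \<open>A\<close>. The
  \<open>card A\<close> events are therefore equally large, and they partition the
  permutations.\<close>

lemma card_permutes_min:
  fixes V :: "nat set"
  assumes "finite V" "A \<subseteq> V" "x \<in> A"
  shows "card {p. p permutes V \<and> (\<forall>y\<in>A - {x}. p x < p y)} * card A = fact (card V)"
proof -
  define M where "M x = {p. p permutes V \<and> (\<forall>y\<in>A - {x}. p x < p y)}" for x
  have finA: "finite A" using assms finite_subset by auto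
  have fin: "finite {p. p permutes V}" using assms finite_permutations by auto
  have finM: "finite (M y)" for y
    unfolding M_def by (rule finite_subset[OF _ fin]) auto
  have img: "(\<lambda>p. p \<circ> transpose y z) ` M y \<subseteq> M z" if "y \<in> A" "z \<in> A" for y z
  proof (rule image_subsetI)
    fix p assume p: "p \<in> M y"
    have "p \<circ> transpose y z permutes V"
      using p that assms by (intro permutes_compose permutes_swap_id) (auto simp: M_def)
    moreover have "(p \<circ> transpose y z) z < (p \<circ> transpose y z) w" if "w \<in> A - {z}" for w
      using p that \<open>y \<in> A\<close> \<open>z \<in> A\<close> by (cases "w = y") (auto simp: M_def)
    ultimately show "p \<circ> transpose y z \<in> M z" by (auto simp: M_def)
  qed
  have eq: "card (M y) = card (M x)" if "y \<in> A" for y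
  proof -
    have "bij_betw (\<lambda>p. p \<circ> transpose y x) (M y) (M x)"
      by (rule bij_betw_byWitness[where f' = "\<lambda>p. p \<circ> transpose y x"])
        (use img[of y x] img[of x y] that assms in \<open>auto simp: comp_assoc transpose_commute\<close>)
    then show ?thesis by (rule bij_betw_same_card)
  qed
  have "{p. p permutes V} \<subseteq> (\<Union>y\<in>A. M y)"
  proof
    fix p assume p: "p \<in> {p. p permutes V}"
    then have inj: "inj p" by (simp add: permutes_inj)
    obtain y where y: "y \<in> A" "\<And>z. z \<in> A \<Longrightarrow> p y \<le> p z"
      using ex_has_least_nat[of "\<lambda>y. y \<in> A" x p] assms by auto
    then have "p \<in> M y"
      using p inj by (auto simp: M_def order_less_le inj_eq)
    with y show "p \<in> (\<Union>y\<in>A. M y)" by blast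
  qed
  then have U: "(\<Union>y\<in>A. M y) = {p. p permutes V}"
    by (auto simp: M_def)
  have "fact (card V) = card (\<Union>y\<in>A. M y)"
    unfolding U using card_permutations[OF refl assms(1)] by simp
  also have "\<dots> = (\<Sum>y\<in>A. card (M y))"
  proof (rule card_UN_disjoint)
    show "\<forall>y\<in>A. \<forall>z\<in>A. y \<noteq> z \<longrightarrow> M y \<inter> M z = {}"
    proof (intro ballI impI)
      fix y z assume "y \<in> A" "z \<in> A" "y \<noteq> z"
      then have "p y < p z" "p z < p y" if "p \<in> M y" "p \<in> M z" for p
        using that by (simp_all add: M_def)
      then show "M y \<inter> M z = {}"
        by (meson disjoint_iff less_asym)
    qed
  qed (use finA finM in auto)
  also have "\<dots> = card (M x) * card A"
    using eq by simp
  finally show ?thesis by (simp add: M_def)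
qed

lemma common_subset_nbrs:
  assumes "E \<in> graphs n"
  shows "common E {a, b} \<subseteq> nbrs E a - {b}"
  using graph_pair(1)[OF assms] by (auto simp: common_def nbrs_def)

lemma common_disjoint:
  assumes "E \<in> graphs n"
  shows "common E e \<inter> e = {}"
  using graph_pair(1)[OF assms] by (auto simp: common_def)

lemma common_subset:
  assumes "E \<in> graphs n" "e \<in> E"
  shows "common E e \<subseteq> {0..<n}"
proof -
  obtain a b where "e = {a, b}" using graph_edgeE[OF assms] by blast
  then show ?thesis using common_subset_nbrs[OF assms(1)] nbrs_subset[OF assms(1)] by blast
qed

lemma finite_common: "E \<in> graphs n \<Longrightarrow> e \<in> E \<Longrightarrow> finite (common E e)"
  by (meson common_subset finite_subset finite_atLeastLessThan)

lemma card_common_less: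
  assumes "E \<in> graphs n" "regular d n E" "e \<in> E"
  shows "card (common E e) < d"
proof -
  obtain a b where e: "e = {a, b}" "a < n" using graph_edgeE[OF assms(1,3)] by blast
  have b: "b \<in> nbrs E a" using e assms(3) by (simp add: nbrs_def insert_commute)
  have "card (common E e) \<le> card (nbrs E a - {b})"
    unfolding e by (intro card_mono common_subset_nbrs[OF assms(1)]) (simp add: finite_nbrs[OF assms(1)])
  also have "\<dots> < card (nbrs E a)"
    using b finite_nbrs[OF assms(1)] by (intro psubset_card_mono) auto
  also have "\<dots> = d" using assms(2) e degree_eq_card_nbrs[OF assms(1)] by (simp add: regular_def)
  finally show ?thesis .
qed

text \<open>The edge survives iff the earliest vertex among its two ends and their \<open>k\<close>
  common neighbours is an end: two disjoint events of probability \<open>1 / (k + 2)\<close>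
  each.\<close>

lemma card_permutes_rest:
  assumes "E \<in> graphs n" "e \<in> E"
  shows "card {p. p permutes {0..<n} \<and> e \<in> rest p E} * (card (common E e) + 2) = 2 * fact n"
proof -
  obtain b c where e: "e = {b, c}" "b \<noteq> c" "b < n" "c < n"
    using graph_edgeE[OF assms] by blast
  define A where "A = e \<union> common E e"
  define M where "M x = {p. p permutes {0..<n} \<and> (\<forall>y\<in>A - {x}. p x < p y)}" for x
  have A: "A \<subseteq> {0..<n}" "b \<in> A" "c \<in> A"
    using common_subset[OF assms] e by (auto simp: A_def)
  have cA: "card A = card (common E e) + 2"
    unfolding A_def using common_disjoint[OF assms(1), of e] finite_common[OF assms] graph_edge[OF assms]
    by (subst card_Un_disjoint) auto
  have fin: "finite {p. p permutes {0..<n}}" using finite_permutations by auto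
  have finM: "finite (M y)" for y
    unfolding M_def by (rule finite_subset[OF _ fin]) auto
  have "{p. p permutes {0..<n} \<and> e \<in> rest p E} = M b \<union> M c"
  proof (intro equalityI subsetI)
    fix p assume p: "p \<in> {p. p permutes {0..<n} \<and> e \<in> rest p E}"
    then have "inj p" by (auto intro: permutes_inj)
    then have "p b \<noteq> p c" using e by (simp add: inj_eq)
    with p show "p \<in> M b \<union> M c"
      by (cases "p b < p c") (fastforce simp: M_def A_def rest_def e)+
  next
    fix p assume p: "p \<in> M b \<union> M c"
    have "b \<notin> common E e" "c \<notin> common E e"
      using common_disjoint[OF assms(1), of e] by (auto simp: e)
    then show "p \<in> {p. p permutes {0..<n} \<and> e \<in> rest p E}"
      using p assms(2) by (auto simp: M_def A_def rest_def e)
  qed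
  moreover have "M b \<inter> M c = {}"
  proof -
    have "p b < p c" "p c < p b" if "p \<in> M b" "p \<in> M c" for p
      using that A e by (simp_all add: M_def)
    then show ?thesis by (meson disjoint_iff less_asym)
  qed
  ultimately have "card {p. p permutes {0..<n} \<and> e \<in> rest p E} = card (M b) + card (M c)"
    using finM by (simp add: card_Un_disjoint)
  then show ?thesis
    using card_permutes_min[of "{0..<n}" A b] card_permutes_min[of "{0..<n}" A c] A
    by (simp add: cA M_def add_mult_distrib)
qed

section \<open>Double counting of edges, triangles and bad nodes\<close>

lemma handshake:
  assumes "E \<in> graphs n" "regular d n E"
  shows "2 * card E = d * n"
proof -
  have "(\<Sum>v\<in>{0..<n}. card {e \<in> E. v \<in> e}) = 2 * card E"
  proof (rule sum_multicount)
    have "{v \<in> {0..<n}. v \<in> e} = e" if "e \<in> E" for e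
      using graph_edge[OF assms(1) that] by auto
    then show "\<forall>e\<in>E. card {v \<in> {0..<n}. v \<in> e} = 2"
      using graph_edge[OF assms(1)] by simp
  qed (use finite_graph[OF assms(1)] in auto)
  moreover have "(\<Sum>v\<in>{0..<n}. card {e \<in> E. v \<in> e}) = d * n"
    using assms(2) by (simp add: regular_def degree_def)
  ultimately show ?thesis by simp
qed

lemma finite_triangles: "finite (triangles n E)"
  by (rule finite_subset[where B = "Pow {0..<n}"]) (auto simp: triangles_def is_clique_def)

lemma triangles_edge:
  assumes "E \<in> graphs n" "e \<in> E"
  shows "bij_betw (\<lambda>a. insert a e) (common E e) {t \<in> triangles n E. e \<subseteq> t}"
  unfolding bij_betw_def
proof
  obtain b c where e: "e = {b, c}" "b \<noteq> c" "b < n" "c < n"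
    using graph_edgeE[OF assms] by blast
  show "inj_on (\<lambda>a. insert a e) (common E e)"
    using common_disjoint[OF assms(1), of e] by (auto simp: inj_on_def)
  show "(\<lambda>a. insert a e) ` common E e = {t \<in> triangles n E. e \<subseteq> t}"
  proof (intro equalityI subsetI)
    fix t assume "t \<in> (\<lambda>a. insert a e) ` common E e"
    then obtain a where a: "a \<in> common E e" "t = insert a e" by blast
    have "a \<in> {0..<n}" "a \<notin> e"
      using a common_subset[OF assms] common_disjoint[OF assms(1), of e] by blast+
    then have "a < n" "a \<noteq> b" "a \<noteq> c" using e(1) by simp_all
    moreover have "{a, b} \<in> E" "{b, a} \<in> E" "{a, c} \<in> E" "{c, a} \<in> E" "{b, c} \<in> E" "{c, b} \<in> E"
      using a e assms(2) by (simp_all add: common_def insert_commute)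
    ultimately show "t \<in> {t \<in> triangles n E. e \<subseteq> t}"
      using a e by (simp add: triangles_def is_clique_def)
  next
    fix t assume t: "t \<in> {t \<in> triangles n E. e \<subseteq> t}"
    then have "card (t - e) = 1"
      using graph_edge[OF assms] by (simp add: triangles_def card_Diff_subset)
    then obtain a where a: "t - e = {a}" by (auto simp: card_1_singleton_iff)
    then have "t = insert a e" "a \<notin> e" using t by auto
    moreover from this have "a \<in> common E e"
      using t by (fastforce simp: common_def triangles_def is_clique_def)
    ultimately show "t \<in> (\<lambda>a. insert a e) ` common E e" by blast
  qed
qed

text \<open>Incidences of edges with triangles are counted in two ways: a common neighbour of the
  ends of \<open>e\<close> is the third vertex of a triangle through \<open>e\<close>, and each
  triangle has three edges.\<close>

lemma sum_card_common:
  assumes "E \<in> graphs n"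
  shows "(\<Sum>e\<in>E. card (common E e)) = 3 * card (triangles n E)"
proof -
  have "(\<Sum>e\<in>E. card (common E e)) = (\<Sum>e\<in>E. card {t \<in> triangles n E. e \<subseteq> t})"
    using bij_betw_same_card[OF triangles_edge[OF assms]] by simp
  also have "\<dots> = 3 * card (triangles n E)"
  proof (rule sum_multicount)
    show "\<forall>t\<in>triangles n E. card {e \<in> E. e \<subseteq> t} = 3"
    proof
      fix t assume t: "t \<in> triangles n E"
      then have "card t = 3" by (simp add: triangles_def)
      then have fin: "finite t" by (simp add: card_ge_0_finite)
      have "{e \<in> E. e \<subseteq> t} = {e. e \<subseteq> t \<and> card e = 2}"
      proof (intro equalityI subsetI)
        fix e assume e: "e \<in> {e. e \<subseteq> t \<and> card e = 2}"
        then obtain a b where "e = {a, b}" "a \<noteq> b" by (auto simp: card_2_iff)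
        moreover from this e have "a \<in> t" "b \<in> t" by simp_all
        ultimately have "e \<in> E" using t by (simp add: triangles_def is_clique_def)
        with e show "e \<in> {e \<in> E. e \<subseteq> t}" by simp
      qed (use graph_edge[OF assms] in auto)
      then show "card {e \<in> E. e \<subseteq> t} = 3"
        using n_subsets[OF fin, of 2] \<open>card t = 3\<close> by (simp add: choose_two)
    qed
  qed (use finite_graph[OF assms] finite_triangles in auto)
  finally show ?thesis .
qed

text \<open>If all triangle edges at a vertex \<open>v\<close> have the maximal number \<open>d - 1\<close> of common neighbours and \<open>v\<close>
  lies in a triangle, then every edge at \<open>v\<close> does, so \<open>v\<close> and its neighbours form a clique.\<close>

lemma bad_nodes_subset:
  assumes E: "E \<in> graphs n" and reg: "regular d n E"
  shows "bad_nodes d n E \<subseteq> \<Union>{e \<in> E. 0 < card (common E e) \<and> card (common E e) + 1 < d}"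
proof (rule ccontr)
  assume "\<not> ?thesis"
  then obtain v where v: "v \<in> bad_nodes d n E"
    and "v \<notin> \<Union>{e \<in> E. 0 < card (common E e) \<and> card (common E e) + 1 < d}" by blast
  then have full: "card (common E {v, u}) + 1 = d"
    if "u \<in> nbrs E v" "common E {v, u} \<noteq> {}" for u
  proof -
    have e: "{v, u} \<in> E" using that by (simp add: nbrs_def insert_commute)
    then have "0 < card (common E {v, u})"
      using that finite_common[OF E] by (simp add: card_gt_0_iff)
    with e \<open>v \<notin> _\<close> card_common_less[OF E reg e] show ?thesis by fastforce
  qed
  have vn: "v < n" using v by (simp add: bad_nodes_def)
  define N where "N = nbrs E v"
  have N: "finite N" "card N = d" "v \<notin> N" "N \<subseteq> {0..<n}"
    using reg vn finite_nbrs[OF E] nbrs_subset[OF E, of v]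
    by (auto simp: N_def regular_def degree_eq_card_nbrs[OF E])
  have common: "common E {v, u} = N - {u}" if "u \<in> N" "common E {v, u} \<noteq> {}" for u
  proof (rule card_subset_eq)
    show "common E {v, u} \<subseteq> N - {u}" using common_subset_nbrs[OF E] by (simp add: N_def)
    show "card (common E {v, u}) = card (N - {u})"
      using full[of u] that N by (simp add: N_def)
  qed (use N in auto)
  obtain t where t: "t \<in> triangles n E" "v \<in> t" using v by (auto simp: bad_nodes_def)
  then have "card (t - {v}) = 2" "finite t"
    by (auto simp: triangles_def card_ge_0_finite)
  then obtain x y where xy: "t - {v} = {x, y}" "x \<noteq> y" by (auto simp: card_2_iff)
  then have "x \<in> t" "y \<in> t" "x \<noteq> v" "y \<noteq> v" by auto
  then have x: "x \<in> N" "y \<in> common E {v, x}"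
    using t xy(2) by (auto simp: N_def nbrs_def common_def triangles_def is_clique_def)
  \<comment> \<open>The edge from \<open>v\<close> to \<open>x\<close> lies in a triangle, so every
    other neighbour \<open>u\<close> of \<open>v\<close> is adjacent to \<open>x\<close>. Then
    \<open>x\<close> is a common neighbour of \<open>v\<close> and \<open>u\<close>, and the edge
    from \<open>v\<close> to \<open>u\<close> lies in a triangle as well.\<close>
  have "common E {v, u} = N - {u}" if "u \<in> N" for u
  proof (cases "u = x")
    case False
    then have "u \<in> common E {v, x}" using common[OF x(1)] x(2) that by auto
    then have "x \<in> common E {v, u}"
      using x(1) by (auto simp: common_def N_def nbrs_def insert_commute)
    then show ?thesis using common[OF that] by auto
  qed (use common x in auto)
  then have "is_clique n E (insert v N)"
    using N vn by (fastforce simp: is_clique_def N_def nbrs_def common_def insert_commute)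
  moreover have "card (insert v N) = d + 1" using N by simp
  ultimately show False using v by (auto simp: bad_nodes_def)
qed

lemma card_bad_nodes_le:
  assumes E: "E \<in> graphs n" and reg: "regular d n E"
  shows "card (bad_nodes d n E) \<le> 2 * card {e \<in> E. 0 < card (common E e) \<and> card (common E e) + 1 < d}"
proof -
  let ?D = "{e \<in> E. 0 < card (common E e) \<and> card (common E e) + 1 < d}"
  have fin: "finite ?D" using finite_graph[OF E] by simp
  have "card (bad_nodes d n E) \<le> card (\<Union>?D)"
    using bad_nodes_subset[OF assms] fin graph_edge[OF E] by (intro card_mono) auto
  also have "\<dots> \<le> (\<Sum>e\<in>?D. card e)"
    using card_UN_le[OF fin, of "\<lambda>e. e"] by simp
  also have "\<dots> = 2 * card ?D"
    using graph_edge[OF E] by simp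
  finally show ?thesis .
qed

text \<open>Here \<open>2 / (k + 2)\<close> is the probability that an edge with \<open>k\<close> common neighbours belongs to
  \<open>rest p E\<close> for a random order \<open>p\<close>; the linear bound is attained only at \<open>k = 0\<close> and \<open>k = d - 1\<close>.\<close>

lemma two_div_le:
  fixes k d :: nat
  assumes "k < d"
  shows "2 / (real k + 2) \<le> 1 - real k / (real d + 1) - (if 0 < k \<and> k + 1 < d then 1 / (real d + 1)^2 else 0)"
proof -
  \<comment> \<open>Writing the gap as one fraction exhibits its zeros \<open>k = 0\<close> and
    \<open>k = d - 1\<close>.\<close>
  have eq: "1 - real k / (real d + 1) - 2 / (real k + 2)
      = real k * (real d - 1 - real k) / ((real d + 1) * (real k + 2))"
    by (simp add: divide_simps) (simp add: algebra_simps)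
  show ?thesis
  proof (cases "0 < k \<and> k + 1 < d")
    case True
    \<comment> \<open>At an intermediate integer \<open>k\<close> both factors of the numerator are
      at least 1, and \<open>k + 2\<close> is at most \<open>d + 1\<close>.\<close>
    then have "1 * 1 \<le> real k * (real d - 1 - real k)" by (intro mult_mono) auto
    moreover have "(real d + 1) * (real k + 2) \<le> (real d + 1) ^ 2"
      using True unfolding power2_eq_square by (intro mult_left_mono) auto
    ultimately have "1 / (real d + 1)^2 \<le> real k * (real d - 1 - real k) / ((real d + 1) * (real k + 2))"
      by (intro frac_le) auto
    then show ?thesis using True eq by auto
  next
    case False
    have "0 \<le> real k * (real d - 1 - real k) / ((real d + 1) * (real k + 2))"
      using assms by (intro divide_nonneg_nonneg mult_nonneg_nonneg) auto
    then show ?thesis using False eq by auto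
  qed
qed

text \<open>Linearity of expectation for a uniformly random order: each edge contributes its
  survival probability, bounded by \<open>two_div_le\<close>. An intermediate edge covers at most
  two bad nodes, hence the 2 in the last denominator.\<close>

lemma sum_card_rest_le:
  assumes E: "E \<in> graphs n" and reg: "regular d n E"
  shows "(\<Sum>p | p permutes {0..<n}. real (card (rest p E))) \<le> fact n *
     (real d * real n / 2 - 3 * real (card (triangles n E)) / (real d + 1)
        - real (card (bad_nodes d n E)) / (2 * (real d + 1)^2))"
proof -
  let ?k = "\<lambda>e. card (common E e)"
  let ?D = "{e \<in> E. 0 < ?k e \<and> ?k e + 1 < d}"
  let ?P = "{p. p permutes {0..<n}}"
  have finP: "finite ?P" using finite_permutations by auto
  have finE: "finite E" using finite_graph[OF E] .
  have "(\<Sum>p\<in>?P. card (rest p E)) = (\<Sum>p\<in>?P. \<Sum>e\<in>E. if e \<in> rest p E then 1 else 0)"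
  proof (rule sum.cong[OF refl])
    fix p
    have "rest p E = {e \<in> E. e \<in> rest p E}" by (auto simp: rest_def)
    then show "card (rest p E) = (\<Sum>e\<in>E. if e \<in> rest p E then 1 else 0)"
      using finE by (simp add: sum.If_cases Int_def)
  qed
  also have "\<dots> = (\<Sum>e\<in>E. card {p. p permutes {0..<n} \<and> e \<in> rest p E})"
    using finP by (subst sum.swap) (simp add: sum.If_cases Int_def)
  finally have "(\<Sum>p\<in>?P. real (card (rest p E))) = (\<Sum>e\<in>E. real (card {p. p permutes {0..<n} \<and> e \<in> rest p E}))"
    by (simp flip: of_nat_sum)
  also have "\<dots> = (\<Sum>e\<in>E. fact n * (2 / (real (?k e) + 2)))"
  proof (rule sum.cong[OF refl])
    fix e assume "e \<in> E"
    then have "real (card {p. p permutes {0..<n} \<and> e \<in> rest p E} * (?k e + 2)) = 2 * fact n"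
      using card_permutes_rest[OF E] by simp
    then show "real (card {p. p permutes {0..<n} \<and> e \<in> rest p E}) = fact n * (2 / (real (?k e) + 2))"
      by (simp add: field_simps)
  qed
  also have "\<dots> \<le> (\<Sum>e\<in>E. fact n * (1 - real (?k e) / (real d + 1)
      - (if 0 < ?k e \<and> ?k e + 1 < d then 1 / (real d + 1)^2 else 0)))"
    using card_common_less[OF E reg] by (intro sum_mono mult_left_mono two_div_le) auto
  also have "\<dots> = fact n * (real (card E) - real (\<Sum>e\<in>E. ?k e) / (real d + 1)
      - real (card ?D) / (real d + 1)^2)"
    using finE by (simp add: sum_distrib_left[symmetric] sum_subtractf sum.If_cases Int_def sum_divide_distrib)
  also have "real (card E) = real d * real n / 2"
    using arg_cong[OF handshake[OF E reg], of real] by simp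
  also have "(\<Sum>e\<in>E. ?k e) = 3 * card (triangles n E)"
    by (rule sum_card_common[OF E])
  also have "fact n * (real d * real n / 2 - real (3 * card (triangles n E)) / (real d + 1)
      - real (card ?D) / (real d + 1)^2) \<le> fact n *
     (real d * real n / 2 - 3 * real (card (triangles n E)) / (real d + 1)
        - real (card (bad_nodes d n E)) / (2 * (real d + 1)^2))"
  proof -
    have "real (card (bad_nodes d n E)) \<le> 2 * real (card ?D)"
      using card_bad_nodes_le[OF E reg] by (simp flip: of_nat_mult)
    then have "real (card (bad_nodes d n E)) / (2 * (real d + 1)^2) \<le> (2 * real (card ?D)) / (2 * (real d + 1)^2)"
      by (intro divide_right_mono) auto
    then show ?thesis
      by (intro mult_left_mono) simp_all
  qed
  finally show ?thesis .
qed

text \<open>Jensen's inequality for the convex function \<open>x powr t\<close> of \<open>t\<close>.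
  The tangent at the mean \<open>a\<close> comes from \<open>exp y >= 1 + y\<close>, and its linear
  terms sum to zero.\<close>

lemma powr_mean_le_sum:
  fixes x :: real and f :: "'a \<Rightarrow> nat"
  assumes "finite P" "P \<noteq> {}" "x > 0"
  shows "real (card P) * x powr ((\<Sum>p\<in>P. real (f p)) / real (card P)) \<le> (\<Sum>p\<in>P. x ^ f p)"
proof -
  define a where "a = (\<Sum>p\<in>P. real (f p)) / real (card P)"
  have c: "real (card P) > 0" using assms by (simp add: card_gt_0_iff)
  have *: "x powr a * (1 + (real (f p) - a) * ln x) \<le> x ^ f p" for p
  proof -
    have "x ^ f p = x powr a * exp ((real (f p) - a) * ln x)"
      using assms(3) by (simp add: powr_def flip: exp_add powr_realpow) (simp add: algebra_simps)
    then show ?thesis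
      by (simp add: mult_left_mono exp_ge_add_one_self)
  qed
  have "(\<Sum>p\<in>P. real (f p) - a) = 0"
    using c by (simp add: sum_subtractf a_def)
  then have "(\<Sum>p\<in>P. x powr a * (1 + (real (f p) - a) * ln x)) = real (card P) * x powr a"
    by (simp add: sum_distrib_left[symmetric] sum.distrib sum_distrib_right[symmetric])
  moreover have "(\<Sum>p\<in>P. x powr a * (1 + (real (f p) - a) * ln x)) \<le> (\<Sum>p\<in>P. x ^ f p)"
    by (intro sum_mono *)
  ultimately show ?thesis by (simp add: a_def)
qed

text \<open>The weights \<open>(1 / n) ^ card (rest p E)\<close> are summed over graphs and orders.
  By Jensen each graph of \<open>B\<close> contributes at least
  \<open>fact n * (1 / n) powr a\<close>, while \<open>sum_rest_le\<close> bounds the contribution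
  of each order; no single order has to suit all graphs.\<close>

lemma card_graphs_le:
  assumes "n > 0"
    and B: "\<And>E. E \<in> B \<Longrightarrow> E \<in> graphs n \<and> regular d n E"
    and a: "\<And>E. E \<in> B \<Longrightarrow> real d * real n / 2 - 3 * real (card (triangles n E)) / (real d + 1)
        - real (card (bad_nodes d n E)) / (2 * (real d + 1)^2) \<le> a"
  shows "real (card B) \<le> (2 ^ (d * d) * exp 1) ^ n * real n powr a"
proof -
  let ?P = "{p. p permutes {0..<n}}"
  define R where "R = {E. E \<in> graphs n \<and> regular d n E}"
  have finP: "finite ?P" using finite_permutations by auto
  have cP: "card ?P = fact n" using card_permutations[of "{0..<n}" n] by simp
  have P0: "?P \<noteq> {}" using permutes_id by blast
  have finR: "finite R" unfolding R_def by (rule finite_subset[OF _ finite_graphs]) auto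
  have BR: "B \<subseteq> R" using B by (auto simp: R_def)
  have each: "fact n * (1 / real n) powr a \<le> (\<Sum>p\<in>?P. (1 / real n) ^ card (rest p E))"
    if "E \<in> B" for E
  proof -
    have E: "E \<in> graphs n" "regular d n E" using B that by auto
    have "(\<Sum>p\<in>?P. real (card (rest p E))) / fact n \<le> a"
      using order_trans[OF sum_card_rest_le[OF E] mult_left_mono[OF a[OF that]]]
      by (simp add: divide_le_eq mult.commute)
    then have "(1 / real n) powr a \<le> (1 / real n) powr ((\<Sum>p\<in>?P. real (card (rest p E))) / fact n)"
      using \<open>n > 0\<close> by (intro powr_mono') auto
    then have "fact n * (1 / real n) powr a \<le> fact n * (1 / real n) powr ((\<Sum>p\<in>?P. real (card (rest p E))) / fact n)"
      by simp
    also have "\<dots> \<le> (\<Sum>p\<in>?P. (1 / real n) ^ card (rest p E))"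
      using powr_mean_le_sum[OF finP P0, of "1 / real n" "\<lambda>p. card (rest p E)"] \<open>n > 0\<close>
      by (simp add: cP)
    finally show ?thesis .
  qed
  have "real (card B) * (fact n * (1 / real n) powr a) \<le> (\<Sum>E\<in>B. \<Sum>p\<in>?P. (1 / real n) ^ card (rest p E))"
    using sum_mono[of B, OF each] by simp
  also have "\<dots> \<le> (\<Sum>E\<in>R. \<Sum>p\<in>?P. (1 / real n) ^ card (rest p E))"
    using BR finR by (intro sum_mono2 sum_nonneg) auto
  also have "\<dots> = (\<Sum>p\<in>?P. \<Sum>E\<in>R. (1 / real n) ^ card (rest p E))"
    by (rule sum.swap)
  also have "\<dots> \<le> (\<Sum>p\<in>?P. (2 ^ (d * d) * exp 1) ^ n)"
    unfolding R_def using \<open>n > 0\<close> by (intro sum_mono sum_rest_le) (auto simp: permutes_inj_on)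
  also have "\<dots> = fact n * (2 ^ (d * d) * exp 1) ^ n"
    by (simp add: cP)
  finally have "fact n * (real (card B) * (1 / real n) powr a) \<le> fact n * (2 ^ (d * d) * exp 1) ^ n"
    by (simp only: ac_simps)
  then have "real (card B) * (1 / real n) powr a \<le> (2 ^ (d * d) * exp 1) ^ n" by simp
  then show ?thesis
    using \<open>n > 0\<close> by (simp add: powr_divide field_simps)
qed

subsection \<open>Many regular graphs with many cliques\<close>

text \<open>\<open>m ^ m / fact m\<close> is a single term of the exponential series of
  \<open>exp m\<close>.\<close>

lemma fact_ge_power: "(real m / exp 1) ^ m \<le> fact m"
proof -
  have "real m ^ m /\<^sub>R fact m = (\<Sum>i\<in>{m}. real m ^ i /\<^sub>R fact i)" by simp
  also have "\<dots> \<le> (\<Sum>i. real m ^ i /\<^sub>R fact i)"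
    using exp_converges[of "real m"] by (intro sum_le_suminf) (auto simp: sums_iff)
  also have "\<dots> = exp 1 ^ m"
    using exp_converges[of "real m"] by (simp add: sums_iff flip: exp_of_nat_mult)
  finally show ?thesis by (simp add: field_simps)
qed

section \<open>Graphs from symmetric relations, and circulant graphs\<close>

definition rel_graph :: "nat \<Rightarrow> (nat \<Rightarrow> nat \<Rightarrow> bool) \<Rightarrow> nat set set" where
  "rel_graph n R = {{u, v} |u v. u < n \<and> v < n \<and> u \<noteq> v \<and> R u v}"

lemma rel_graph_in_graphs: "rel_graph n R \<in> graphs n"
  by (auto simp: rel_graph_def graphs_def)

lemma rel_graph_iff:
  assumes "\<And>u v. R u v \<Longrightarrow> R v u"
  shows "{u, v} \<in> rel_graph n R \<longleftrightarrow> u < n \<and> v < n \<and> u \<noteq> v \<and> R u v"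
  unfolding rel_graph_def using assms by (auto simp: doubleton_eq_iff)

lemma regular_rel_graph:
  assumes "\<And>u v. R u v \<Longrightarrow> R v u"
    and "\<And>v. v < n \<Longrightarrow> card {u. u < n \<and> u \<noteq> v \<and> R u v} = d"
  shows "regular d n (rel_graph n R)"
proof -
  have "nbrs (rel_graph n R) v = {u. u < n \<and> u \<noteq> v \<and> R u v}" if "v < n" for v
    using that by (auto simp: nbrs_def rel_graph_iff[of R, OF assms(1)])
  then show ?thesis
    using assms(2) by (simp add: regular_def degree_eq_card_nbrs[OF rel_graph_in_graphs])
qed

text \<open>Connection set of a circulant graph: the \<open>d div 2\<close> smallest and the
  \<open>d div 2\<close> largest nonzero residues. If \<open>d\<close> is odd, then \<open>s\<close>
  is even, and \<open>s / 2\<close>, which is its own negative, is added.\<close>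

lemma symmetric_residues:
  assumes "d < s" "even (s * d)"
  shows "\<exists>D. D \<subseteq> {1..<int s} \<and> card D = d \<and> (\<forall>x\<in>D. int s - x \<in> D)"
proof -
  define k where "k = int d div 2"
  define D0 where "D0 = {1..k} \<union> {int s - k..<int s}"
  have k: "0 \<le> k" "2 * k \<le> int d" by (auto simp: k_def)
  have "card D0 = card {1..k} + card {int s - k..<int s}"
    unfolding D0_def using k assms by (intro card_Un_disjoint) auto
  then have c0: "card D0 = 2 * nat k" by simp
  have D0: "D0 \<subseteq> {1..<int s}" "\<forall>x\<in>D0. int s - x \<in> D0" "finite D0"
    using k assms by (auto simp: D0_def)
  show ?thesis
  proof (cases "even d")
    case True
    then have "2 * nat k = d" by (simp add: k_def nat_div_distrib)
    with c0 D0 show ?thesis by auto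
  next
    case False
    then obtain r where r: "s = 2 * r" using assms by auto
    have d: "d = 2 * nat k + 1"
      using False by (simp add: k_def nat_div_distrib)
    then have "int r \<notin> D0" using assms r k by (auto simp: D0_def)
    then have "card (insert (int r) D0) = d" using D0 c0 d by simp
    moreover have "insert (int r) D0 \<subseteq> {1..<int s}" using D0 assms r d by auto
    moreover have "\<forall>x\<in>insert (int r) D0. int s - x \<in> insert (int r) D0" using D0 r by auto
    ultimately show ?thesis by blast
  qed
qed

text \<open>Adjacency depends only on the difference modulo \<open>s\<close>, so subtracting
  \<open>v\<close> maps the neighbours of \<open>v\<close> bijectively to the connection set
  \<open>D\<close>.\<close>

lemma circulant:
  assumes "d < s" "even (s * d)"
  shows "\<exists>R :: nat \<Rightarrow> nat \<Rightarrow> bool. (\<forall>u v. R u v \<longrightarrow> R v u) \<and> (\<forall>v. \<not> R v v) \<and>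
    (\<forall>v<s. card {u. u < s \<and> R u v} = d)"
proof -
  obtain D where D: "D \<subseteq> {1..<int s}" "card D = d" "\<And>x. x \<in> D \<Longrightarrow> int s - x \<in> D"
    using symmetric_residues[OF assms] by blast
  define R where "R u v \<longleftrightarrow> (int u - int v) mod int s \<in> D" for u v :: nat
  have "R v u" if "R u v" for u v
  proof -
    have "(int u - int v) mod int s \<noteq> 0" using that D(1) by (auto simp: R_def)
    then have "(int v - int u) mod int s = int s - (int u - int v) mod int s"
      using zmod_zminus1_eq_if[of "int u - int v" "int s"] by simp
    then show ?thesis using D(3) that by (simp add: R_def)
  qed
  moreover have "\<not> R v v" for v using D(1) by (auto simp: R_def)
  moreover have "card {u. u < s \<and> R u v} = d" if "v < s" for v
  proof -
    have "bij_betw (\<lambda>u. (int u - int v) mod int s) {u. u < s \<and> R u v} D"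
    proof (rule bij_betw_byWitness[where f' = "\<lambda>x. nat ((x + int v) mod int s)"])
      show "\<forall>u\<in>{u. u < s \<and> R u v}. nat (((int u - int v) mod int s + int v) mod int s) = u"
        by (simp add: mod_simps)
      have inv: "(int (nat ((x + int v) mod int s)) - int v) mod int s = x" if "x \<in> D" for x
      proof -
        have "x mod int s = x" using that D(1) by (intro mod_pos_pos_trivial) auto
        then show ?thesis using \<open>v < s\<close> by (simp add: mod_simps)
      qed
      then show "\<forall>x\<in>D. (int (nat ((x + int v) mod int s)) - int v) mod int s = x" by blast
      show "(\<lambda>u. (int u - int v) mod int s) ` {u. u < s \<and> R u v} \<subseteq> D"
        by (auto simp: R_def)
      show "(\<lambda>x. nat ((x + int v) mod int s)) ` D \<subseteq> {u. u < s \<and> R u v}"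
        using \<open>v < s\<close> inv by (auto simp: R_def nat_less_iff)
    qed
    then show ?thesis using D(2) by (simp add: bij_betw_same_card)
  qed
  ultimately show ?thesis by blast
qed

text \<open>The \<open>n\<close> vertices consist of \<open>s\<close> vertices carrying the \<open>d\<close>-regular graph \<open>C\<close>, which absorb the residue
  of \<open>n\<close> modulo \<open>d + 1\<close>, and of \<open>d + 1\<close> classes of size \<open>q\<close>. Any choice of perfect matchings
  \<open>T (i, i')\<close> from class \<open>i'\<close> to class \<open>i\<close>, for all \<open>i' < i\<close>, gives a \<open>d\<close>-regular graph. On the indices
  below \<open>k\<close> the matchings are made compatible, which creates \<open>k\<close> cliques of size \<open>d + 1\<close>; on the
  remaining indices they are arbitrary.\<close>

locale construction =
  fixes d s q k :: nat and C :: "nat \<Rightarrow> nat \<Rightarrow> bool"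
  assumes ds: "d < s" and kq: "k \<le> q"
    and C_sym: "C u v \<Longrightarrow> C v u" and C_irrefl: "\<not> C v v"
    and C_deg: "v < s \<Longrightarrow> card {u. u < s \<and> C u v} = d"
begin

definition n :: nat where "n = s + q * (d + 1)"
text \<open>Each block of \<open>d + 1\<close> consecutive numbers holds one vertex of every class,
  so remainder and quotient recover class and index.\<close>

definition vert :: "nat \<Rightarrow> nat \<Rightarrow> nat" where "vert i j = s + (j * (d + 1) + i)"
definition cls :: "nat \<Rightarrow> nat" where "cls u = (u - s) mod (d + 1)"
definition idx :: "nat \<Rightarrow> nat" where "idx u = (u - s) div (d + 1)"

text \<open>Each matching is stored once, with the larger class first; both orientations are listed
  to keep the relation symmetric.\<close>

definition link :: "(nat \<times> nat \<Rightarrow> nat \<Rightarrow> nat) \<Rightarrow> nat \<Rightarrow> nat \<Rightarrow> bool" where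
  "link T u v \<longleftrightarrow> (u < s \<and> v < s \<and> C u v) \<or> (s \<le> u \<and> s \<le> v \<and>
     (cls u < cls v \<and> idx v = T (cls v, cls u) (idx u) \<or>
      cls v < cls u \<and> idx u = T (cls u, cls v) (idx v)))"

definition pairs :: "(nat \<times> nat) set" where "pairs = (SIGMA i:{..d}. {..<i})"

lemma vert_simps [simp]:
  assumes "i \<le> d"
  shows "cls (vert i j) = i" "idx (vert i j) = j" "s \<le> vert i j"
  using assms by (simp_all add: cls_def idx_def vert_def less_Suc_eq_le del: mult_Suc_right)

lemma vert_less:
  assumes "i \<le> d" "j < q"
  shows "vert i j < n"
proof -
  have "j * (d + 1) + i < (j + 1) * (d + 1)" using assms by simp
  also have "\<dots> \<le> q * (d + 1)" using assms by (intro mult_right_mono) auto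
  finally show ?thesis by (simp add: vert_def n_def)
qed

lemma vert_eq_iff [simp]:
  assumes "i \<le> d" "i' \<le> d"
  shows "vert i j = vert i' j' \<longleftrightarrow> i = i' \<and> j = j'"
  using assms vert_simps by metis

lemma vert_cls_idx:
  assumes "s \<le> u" "u < n"
  shows "vert (cls u) (idx u) = u" "cls u \<le> d" "idx u < q"
proof -
  show "vert (cls u) (idx u) = u" using assms by (simp add: vert_def cls_def idx_def del: mult_Suc_right)
  show "cls u \<le> d" by (simp add: cls_def flip: less_Suc_eq_le)
  show "idx u < q" using assms unfolding idx_def n_def
    by (intro less_mult_imp_div_less) auto
qed

lemma link_sym: "link T u v \<Longrightarrow> link T v u"
  using C_sym by (auto simp: link_def)

lemma link_vert:
  assumes "i < i'" "i' \<le> d"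
  shows "link T (vert i j) (vert i' j') \<longleftrightarrow> j' = T (i', i) j"
proof -
  have "\<not> vert i j < s" "\<not> vert i' j' < s" using assms by (simp_all add: not_less)
  then show ?thesis using assms by (simp add: link_def)
qed

text \<open>A vertex \<open>v\<close> outside the base graph has exactly one neighbour in each of
  the \<open>d\<close> other classes. Its index is \<open>t i\<close>, read through the inverse
  matching when \<open>i < cls v\<close>.\<close>

lemma regular_link:
  assumes T: "\<And>z. z \<in> pairs \<Longrightarrow> T z permutes {0..<q}"
  shows "regular d n (rel_graph n (link T))"
proof (rule regular_rel_graph)
  fix v assume v: "v < n"
  show "card {u. u < n \<and> u \<noteq> v \<and> link T u v} = d"
  proof (cases "v < s")
    case True
    then have "{u. u < n \<and> u \<noteq> v \<and> link T u v} = {u. u < s \<and> C u v}"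
      using C_irrefl by (auto simp: link_def n_def)
    then show ?thesis using C_deg True by simp
  next
    case False
    then have v': "vert (cls v) (idx v) = v" "cls v \<le> d" "idx v < q" "s \<le> v"
      using vert_cls_idx[of v] v by auto
    define t where "t i = (if i < cls v then inv (T (cls v, i)) (idx v) else T (i, cls v) (idx v))" for i
    have perm: "T (i, i') permutes {0..<q}" if "i' < i" "i \<le> d" for i i'
      using T that by (auto simp: pairs_def)
    have t: "t i < q" if "i \<le> d" "i \<noteq> cls v" for i
    proof (cases "i < cls v")
      case True
      then show ?thesis
        using permutes_in_image[OF permutes_inv[OF perm[of i "cls v"]], of "idx v"] v' by (simp add: t_def)
    next
      case False
      then show ?thesis
        using permutes_in_image[OF perm[of "cls v" i], of "idx v"] v' that by (simp add: t_def)
    qed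
    have link: "link T (vert i j) v \<longleftrightarrow> i \<noteq> cls v \<and> j = t i" if "i \<le> d" for i j
    proof (cases i "cls v" rule: linorder_cases)
      case less
      then have "link T (vert i j) v \<longleftrightarrow> idx v = T (cls v, i) j"
        using link_vert[OF less v'(2), of T j "idx v"] v' by simp
      also have "\<dots> \<longleftrightarrow> j = inv (T (cls v, i)) (idx v)"
        using perm[OF less v'(2)] by (metis permutes_inverses)
      finally show ?thesis using less by (simp add: t_def)
    next
      case greater
      then have "link T (vert i j) v \<longleftrightarrow> j = T (i, cls v) (idx v)"
        using link_vert[OF greater that, of T "idx v" j] v' link_sym by metis
      then show ?thesis using greater by (simp add: t_def)
    next
      case equal
      then show ?thesis using that v' by (simp add: link_def)
    qed
    have "{u. u < n \<and> u \<noteq> v \<and> link T u v} = (\<lambda>i. vert i (t i)) ` ({..d} - {cls v})"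
    proof (intro equalityI subsetI)
      fix u assume u: "u \<in> {u. u < n \<and> u \<noteq> v \<and> link T u v}"
      then have "s \<le> u" using v' by (auto simp: link_def)
      then have "vert (cls u) (idx u) = u" "cls u \<le> d" using vert_cls_idx u by auto
      then show "u \<in> (\<lambda>i. vert i (t i)) ` ({..d} - {cls v})"
        using u link[of "cls u" "idx u"] by (metis (no_types, lifting) DiffI atMost_iff image_eqI mem_Collect_eq singletonD)
    next
      fix u assume "u \<in> (\<lambda>i. vert i (t i)) ` ({..d} - {cls v})"
      then obtain i where i: "i \<le> d" "i \<noteq> cls v" "u = vert i (t i)" by auto
      then have "cls u = i" by simp
      then have "u \<noteq> v" using i(2) by blast
      then show "u \<in> {u. u < n \<and> u \<noteq> v \<and> link T u v}"
        using i link t vert_less by auto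
    qed
    moreover have "inj_on (\<lambda>i. vert i (t i)) ({..d} - {cls v})"
      by (auto simp: inj_on_def)
    ultimately show ?thesis
      using v' by (simp add: card_image)
  qed
qed (rule link_sym)

text \<open>On indices \<open>j < k\<close>, \<open>pivot f i j\<close> is the index in class
  \<open>i\<close> of the vertex in clique \<open>j\<close>. The identity on class 0 numbers the
  cliques by their vertex there, so renumbering the cliques does not yield the same graph
  twice.\<close>

definition pivot :: "(nat \<Rightarrow> nat \<Rightarrow> nat) \<Rightarrow> nat \<Rightarrow> nat \<Rightarrow> nat" where
  "pivot f i = (if i = 0 then id else f i)"

text \<open>For parameters in \<open>params\<close> the pivots move only indices below
  \<open>k\<close> and \<open>g\<close> only the others, so one composition serves both. Below
  \<open>k\<close> the matchings pass through the common clique number, which makes them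
  compatible.\<close>

definition weave :: "(nat \<Rightarrow> nat \<Rightarrow> nat) \<times> (nat \<times> nat \<Rightarrow> nat \<Rightarrow> nat) \<Rightarrow> nat \<times> nat \<Rightarrow> nat \<Rightarrow> nat" where
  "weave = (\<lambda>(f, g) (i, i'). pivot f i \<circ> inv (pivot f i') \<circ> g (i, i'))"

definition params :: "((nat \<Rightarrow> nat \<Rightarrow> nat) \<times> (nat \<times> nat \<Rightarrow> nat \<Rightarrow> nat)) set" where
  "params = ({1..d} \<rightarrow>\<^sub>E {p. p permutes {0..<k}}) \<times> (pairs \<rightarrow>\<^sub>E {p. p permutes {k..<q}})"

lemma card_params: "card params = fact k ^ d * fact (q - k) ^ (d * (d + 1) div 2)"
proof -
  have "card pairs = (\<Sum>i\<le>d. i)" by (simp add: pairs_def)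
  also have "\<dots> = d * (d + 1) div 2" using gauss_sum_nat[of d] by (simp add: atMost_atLeast0)
  finally have "card pairs = d * (d + 1) div 2" .
  moreover have "finite pairs" by (simp add: pairs_def)
  ultimately show ?thesis
    by (simp add: params_def card_cartesian_product card_PiE card_permutations)
qed

lemma pivot_permutes:
  assumes "(f, g) \<in> params" "i \<le> d"
  shows "pivot f i permutes {0..<k}"
  using assms by (auto simp: params_def pivot_def permutes_id)

lemma fill_permutes:
  assumes "(f, g) \<in> params" "z \<in> pairs"
  shows "g z permutes {k..<q}"
  using assms by (auto simp: params_def)

lemma weave_permutes:
  assumes "fg \<in> params" "z \<in> pairs"
  shows "weave fg z permutes {0..<q}"
proof -
  obtain f g where fg: "fg = (f, g)" by fastforce
  obtain i i' where z: "z = (i, i')" by fastforce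
  have "i \<le> d" "i' \<le> d" using assms(2) by (auto simp: z pairs_def)
  then have "pivot f i permutes {0..<q}" "inv (pivot f i') permutes {0..<q}" "g z permutes {0..<q}"
    using pivot_permutes[of f g i] pivot_permutes[of f g i'] fill_permutes[of f g z] assms kq fg
    by (auto intro!: permutes_inv intro: permutes_subset)
  then show ?thesis
    by (simp add: fg z weave_def permutes_compose)
qed

lemma weave_low:
  assumes "(f, g) \<in> params" "i' < i" "i \<le> d" "j < k"
  shows "weave (f, g) (i, i') (pivot f i' j) = pivot f i j"
proof -
  have p: "pivot f i' permutes {0..<k}" using pivot_permutes[OF assms(1)] assms by simp
  then have "pivot f i' j < k" using permutes_in_image[OF p, of j] assms by simp
  moreover have "g (i, i') permutes {k..<q}"
    using fill_permutes[OF assms(1)] assms by (simp add: pairs_def)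
  ultimately have "g (i, i') (pivot f i' j) = pivot f i' j"
    by (simp add: permutes_not_in)
  then show ?thesis using permutes_inverses(2)[OF p] by (simp add: weave_def)
qed

lemma weave_high:
  assumes "(f, g) \<in> params" "i' < i" "i \<le> d" "k \<le> j" "j < q"
  shows "weave (f, g) (i, i') j = g (i, i') j"
proof -
  have "g (i, i') permutes {k..<q}"
    using fill_permutes[OF assms(1)] assms by (simp add: pairs_def)
  then have "k \<le> g (i, i') j" using permutes_in_image[of "g (i, i')" "{k..<q}" j] assms by simp
  moreover have "pivot f i permutes {0..<k}" "inv (pivot f i') permutes {0..<k}"
    using pivot_permutes[OF assms(1)] assms by (auto intro: permutes_inv)
  ultimately show ?thesis by (simp add: weave_def permutes_not_in)
qed

text \<open>The graph determines every matching on indices below \<open>q\<close>. The high indices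
  give back \<open>g\<close>; the matchings out of class 0, whose pivot is the identity, give back
  \<open>f\<close> on the low ones.\<close>

lemma inj_on_weave: "inj_on (\<lambda>fg. rel_graph n (link (weave fg))) params"
proof (rule inj_onI)
  fix fg fg' assume fg: "fg \<in> params" and fg': "fg' \<in> params"
    and eq: "rel_graph n (link (weave fg)) = rel_graph n (link (weave fg'))"
  obtain f g f' g' where ex: "fg = (f, g)" "fg' = (f', g')" by fastforce
  have weave: "weave fg (i, i') j = weave fg' (i, i') j" if "i' < i" "i \<le> d" "j < q" for i i' j
  proof -
    have "weave fg (i, i') j < q"
      using permutes_in_image[OF weave_permutes[OF fg], of "(i, i')" j] that by (simp add: pairs_def)
    then have "{vert i' j, vert i (weave fg (i, i') j)} \<in> rel_graph n (link (weave fg))"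
      using that by (simp add: rel_graph_iff[OF link_sym] link_vert vert_less)
    then show ?thesis
      unfolding eq using that by (simp add: rel_graph_iff[OF link_sym] link_vert)
  qed
  have "g z = g' z" if zp: "z \<in> pairs" for z
  proof
    fix j
    have perm: "g z permutes {k..<q}" "g' z permutes {k..<q}"
      using fill_permutes zp fg fg' ex by simp_all
    obtain i i' where z: "z = (i, i')" "i' < i" "i \<le> d" using zp by (auto simp: pairs_def)
    show "g z j = g' z j"
    proof (cases "k \<le> j \<and> j < q")
      case True
      then show ?thesis
        using weave weave_high fg fg' z ex by metis
    next
      case False
      then show ?thesis
        using perm by (auto simp: permutes_not_in)
    qed
  qed
  moreover have "g \<in> pairs \<rightarrow>\<^sub>E {p. p permutes {k..<q}}" "g' \<in> pairs \<rightarrow>\<^sub>E {p. p permutes {k..<q}}"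
    using fg fg' ex by (simp_all add: params_def)
  ultimately have "g = g'" by - (rule PiE_ext, assumption, assumption, simp)
  have "f i = f' i" if i: "i \<in> {1..d}" for i
  proof
    fix j
    show "f i j = f' i j"
    proof (cases "j < k")
      case True
      have "weave (f, g) (i, 0) j = f i j" "weave (f', g') (i, 0) j = f' i j"
        using weave_low[of f g 0 i j] weave_low[of f' g' 0 i j] True i fg fg' ex by (auto simp: pivot_def)
      then show ?thesis
        using weave[of 0 i j] i True kq ex by simp
    next
      case False
      have "f i permutes {0..<k}" "f' i permutes {0..<k}"
        using pivot_permutes[of f g i] pivot_permutes[of f' g' i] i fg fg' ex by (auto simp: pivot_def)
      then show ?thesis
        using False by (simp add: permutes_not_in)
    qed
  qed
  moreover have "f \<in> {1..d} \<rightarrow>\<^sub>E {p. p permutes {0..<k}}" "f' \<in> {1..d} \<rightarrow>\<^sub>E {p. p permutes {0..<k}}"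
    using fg fg' ex by (simp_all add: params_def)
  ultimately have "f = f'" by - (rule PiE_ext, assumption, assumption, simp)
  with \<open>g = g'\<close> show "fg = fg'" using ex by simp
qed

text \<open>\<open>K j\<close> is clique number \<open>j\<close>. Injectivity of the pivots makes
  these cliques disjoint, so no triangle is counted twice.\<close>

lemma card_triangles_weave:
  assumes "fg \<in> params"
  shows "k * ((d + 1) choose 3) \<le> card (triangles n (rel_graph n (link (weave fg))))"
proof -
  obtain f g where fg: "fg = (f, g)" by fastforce
  let ?E = "rel_graph n (link (weave fg))"
  define K where "K j = (\<lambda>i. vert i (pivot f i j)) ` {..d}" for j
  define \<T> where "\<T> j = {t. t \<subseteq> K j \<and> card t = 3}" for j
  have piv: "pivot f i j < k" if "i \<le> d" "j < k" for i j
    using permutes_in_image[OF pivot_permutes, of f g i j] assms fg that by simp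
  have fin: "finite (K j)" for j by (simp add: K_def)
  have cK: "card (K j) = d + 1" for j
    unfolding K_def by (subst card_image) (auto simp: inj_on_def)
  have cT: "card (\<T> j) = (d + 1) choose 3" for j
    unfolding \<T>_def using n_subsets[OF fin] cK by simp
  have link: "link (weave fg) (vert i (pivot f i j)) (vert i' (pivot f i' j))"
    if "i < i'" "i' \<le> d" "j < k" for i i' j
    using weave_low[of f g i i' j] assms fg that by (simp add: link_vert)
  have clique: "is_clique n ?E (K j)" if "j < k" for j
    unfolding is_clique_def
  proof (intro conjI ballI impI)
    show "K j \<subseteq> {0..<n}"
      using piv that kq by (auto simp: K_def intro!: vert_less) (meson less_le_trans)
    fix u v assume "u \<in> K j" "v \<in> K j" "u \<noteq> v"
    then obtain i i' where i: "u = vert i (pivot f i j)" "v = vert i' (pivot f i' j)" "i \<le> d" "i' \<le> d" "i \<noteq> i'"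
      by (auto simp: K_def)
    then have "link (weave fg) u v"
      using link that link_sym by (metis linorder_neqE_nat)
    moreover have "u < n" "v < n"
      using \<open>K j \<subseteq> {0..<n}\<close> \<open>u \<in> K j\<close> \<open>v \<in> K j\<close> by auto
    ultimately show "{u, v} \<in> ?E"
      using \<open>u \<noteq> v\<close> by (simp add: rel_graph_iff[OF link_sym])
  qed
  have sub: "(\<Union>j<k. \<T> j) \<subseteq> triangles n ?E"
  proof (rule UN_least)
    fix j assume "j \<in> {..<k}"
    then have "is_clique n ?E t" if "t \<in> \<T> j" for t
      using clique[of j] that unfolding is_clique_def \<T>_def by blast
    then show "\<T> j \<subseteq> triangles n ?E" by (auto simp: \<T>_def triangles_def)
  qed
  have disj: "\<T> j \<inter> \<T> j' = {}" if "j < k" "j' < k" "j \<noteq> j'" for j j'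
  proof -
    have "K j \<inter> K j' = {}"
    proof (rule ccontr)
      assume "K j \<inter> K j' \<noteq> {}"
      then obtain i where "i \<le> d" "pivot f i j = pivot f i j'" by (auto simp: K_def)
      moreover have "inj (pivot f i)" if "i \<le> d"
        using pivot_permutes assms fg that permutes_inj by metis
      ultimately show False using that by (simp add: inj_eq)
    qed
    then have "t = {}" if "t \<in> \<T> j" "t \<in> \<T> j'" for t
      using that unfolding \<T>_def by blast
    moreover have "{} \<notin> \<T> j" by (simp add: \<T>_def)
    ultimately show ?thesis by blast
  qed
  have "k * ((d + 1) choose 3) = (\<Sum>j<k. card (\<T> j))" by (simp add: cT)
  also have "\<dots> = card (\<Union>j<k. \<T> j)"
    using disj fin by (subst card_UN_disjoint) (auto simp: \<T>_def)
  also have "\<dots> \<le> card (triangles n ?E)"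
    by (intro card_mono sub) (rule finite_subset[where B = "Pow {0..<n}"], auto simp: triangles_def is_clique_def)
  finally show ?thesis .
qed

text \<open>Since \<open>3 * ((d + 1) choose 3) = (d + 1) * (d choose 2)\<close>, disjoint cliques
  covering a fraction \<open>c\<close> of the vertices contain at least \<open>c * T_max d n\<close>
  triangles.\<close>

lemma card_G_dc_weave_ge:
  assumes "c * real n \<le> real k * (real d + 1)"
  shows "fact k ^ d * fact (q - k) ^ (d * (d + 1) div 2) \<le> card (G_dc d c n)"
proof -
  have "rel_graph n (link (weave fg)) \<in> G_dc d c n" if "fg \<in> params" for fg
  proof -
    have "3 * ((d + 1) choose 3) = (d + 1) * (d choose 2)"
      using binomial_absorption[of 2 "d + 1"] by (simp add: numeral_3_eq_3)
    then have "3 * real ((d + 1) choose 3) = (real d + 1) * real (d choose 2)"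
      by (metis of_nat_Suc of_nat_mult of_nat_numeral Suc_eq_plus1 add.commute)
    then have eq: "real (k * ((d + 1) choose 3)) = real k * (real d + 1) * real (d choose 2) / 3"
      by simp
    have "c * T_max d n = c * real n * real (d choose 2) / 3"
      by (simp add: T_max_def)
    also have "\<dots> \<le> real (k * ((d + 1) choose 3))"
      unfolding eq using assms by (intro divide_right_mono mult_right_mono) auto
    also have "\<dots> \<le> real (card (triangles n (rel_graph n (link (weave fg)))))"
      using card_triangles_weave[OF that] by linarith
    finally show ?thesis
      using regular_link[OF weave_permutes[OF that]] by (simp add: G_dc_def rel_graph_in_graphs)
  qed
  then have "card params \<le> card (G_dc d c n)"
    by (intro card_inj_on_le[OF inj_on_weave]) (auto simp: G_dc_def intro: finite_subset[OF _ finite_graphs])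
  then show ?thesis by (simp only: card_params)
qed

end

lemma card_G_dc_ge:
  assumes "d < s" "even (s * d)" "k \<le> q" "n = s + q * (d + 1)"
    and "c * real n \<le> real k * (real d + 1)"
  shows "fact k ^ d * fact (q - k) ^ (d * (d + 1) div 2) \<le> card (G_dc d c n)"
proof -
  obtain R where "construction d s q k R"
    using circulant[OF assms(1,2)] assms(1,3) by (auto simp: construction_def)
  then interpret construction d s q k R .
  show ?thesis using card_G_dc_weave_ge[of c] assms(4,5) by (simp add: n_def)
qed

subsection \<open>Comparison of the two counts\<close>

lemma real_choose_two: "real (d choose 2) = real d * (real d - 1) / 2"
  by (induction d) (simp_all add: numeral_2_eq_2 field_simps)

text \<open>Up to factors exponential in \<open>n\<close>, the set \<open>G_dc d c n\<close> has \<open>n\<close> to the power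
  \<open>growth d c * n\<close> elements.\<close>

definition growth :: "nat \<Rightarrow> real \<Rightarrow> real" where
  "growth d c = real d / 2 - c * (real d * (real d - 1)) / (2 * (real d + 1))"

text \<open>The threshold values for triangles and bad nodes are put into
  \<open>card_graphs_le\<close>; \<open>3 * c * T_max d n / (d + 1)\<close> is the subtracted term
  of \<open>growth d c\<close>, times \<open>n\<close>.\<close>

lemma card_many_bad_le:
  assumes "n > 0"
  shows "real (card {E \<in> G_dc d c n. real (card (bad_nodes d n E)) > \<epsilon> * real n})
    \<le> (2 ^ (d * d) * exp 1) ^ n * real n powr (growth d c * real n - \<epsilon> * real n / (2 * (real d + 1)^2))"
proof (rule card_graphs_le[OF assms])
  fix E assume E: "E \<in> {E \<in> G_dc d c n. real (card (bad_nodes d n E)) > \<epsilon> * real n}"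
  then show "E \<in> graphs n \<and> regular d n E" by (simp add: G_dc_def)
  have "c * (real d * (real d - 1)) / (2 * (real d + 1)) * real n = 3 * (c * T_max d n) / (real d + 1)"
    by (simp add: T_max_def real_choose_two)
  also have "\<dots> \<le> 3 * real (card (triangles n E)) / (real d + 1)"
    using E by (intro divide_right_mono mult_left_mono) (auto simp: G_dc_def)
  finally have "c * (real d * (real d - 1)) / (2 * (real d + 1)) * real n
      \<le> 3 * real (card (triangles n E)) / (real d + 1)" .
  moreover have "\<epsilon> * real n / (2 * (real d + 1)^2) \<le> real (card (bad_nodes d n E)) / (2 * (real d + 1)^2)"
    using E by (intro divide_right_mono) auto
  ultimately show "real d * real n / 2 - 3 * real (card (triangles n E)) / (real d + 1)
        - real (card (bad_nodes d n E)) / (2 * (real d + 1)^2)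
      \<le> growth d c * real n - \<epsilon> * real n / (2 * (real d + 1)^2)"
    by (simp add: growth_def left_diff_distrib)
qed

text \<open>If \<open>m\<close> is a positive fraction of \<open>n\<close>, then
  \<open>fact m\<close> is at least \<open>n ^ m\<close> up to an exponential factor. As its base is
  at most 1, that factor may be given the exponent \<open>n\<close>, independent of
  \<open>m\<close>.\<close>

lemma fact_ge_linear:
  assumes "0 < \<beta>" "\<beta> \<le> 1" "\<beta> * real n \<le> real m" "m \<le> n"
  shows "real n ^ m * (\<beta> / exp 1) ^ n \<le> fact m"
proof -
  have "(\<beta> / exp 1) ^ n \<le> (\<beta> / exp 1) ^ m"
    using assms exp_ge_add_one_self[of 1] by (intro power_decreasing) (auto simp: divide_le_eq)
  then have "real n ^ m * (\<beta> / exp 1) ^ n \<le> real n ^ m * (\<beta> / exp 1) ^ m"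
    by (intro mult_left_mono) auto
  also have "\<dots> = (\<beta> * real n / exp 1) ^ m"
    by (simp add: power_divide power_mult_distrib)
  also have "\<dots> \<le> (real m / exp 1) ^ m"
    using assms by (intro power_mono divide_right_mono) auto
  also have "\<dots> \<le> fact m" by (rule fact_ge_power)
  finally show ?thesis .
qed

text \<open>For odd \<open>d * n\<close> there is no \<open>d\<close>-regular graph. Otherwise the
  construction is used with \<open>q\<close> about \<open>n / (d + 1)\<close> and \<open>k\<close>
  about \<open>c\<close> times that; its exponent \<open>k * d + (q - k) * P\<close> is then
  \<open>growth d c * n\<close> up to a constant.\<close>

lemma card_G_dc_lower_bound:
  assumes "0 < c" "c < 1"
  shows "\<exists>b W. b > 0 \<and> W \<ge> 0 \<and> (\<forall>\<^sub>F n in sequentially. even (d * n) \<longrightarrow>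
    b ^ n * real n powr (growth d c * real n - W) \<le> real (card (G_dc d c n)))"
proof -
  \<comment> \<open>A lower bound for both \<open>k / n\<close> and \<open>(q - k) / n\<close>; the
    2 in the denominator leaves room for rounding.\<close>
  define \<beta> where "\<beta> = min c (1 - c) / (2 * (real d + 1))"
  define P where "P = d * (d + 1) div 2"
  \<comment> \<open>The first term is the loss from using only \<open>q >= x - 2\<close>, the second
    the loss from rounding \<open>k\<close> up.\<close>
  define W where "W = real d * (real d + 1) + real d * (real d - 1) / 2"
  define b where "b = (\<beta> / exp 1) ^ (d + P)"
  have \<beta>: "0 < \<beta>" using assms by (simp add: \<beta>_def)
  have "min c (1 - c) \<le> 1" using assms by simp
  then have \<beta>1: "\<beta> \<le> 1" unfolding \<beta>_def using assms by (simp add: divide_le_eq)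
  have P: "real P = real d * (real d + 1) / 2"
    by (simp add: P_def real_of_nat_div algebra_simps)
  have d0: "0 \<le> real d * (real d - 1) / 2" by (cases d) auto
  have bound: "b ^ n * real n powr (growth d c * real n - W) \<le> real (card (G_dc d c n))"
    if ev: "even (d * n)" and n: "d + 1 \<le> n" "6 * (real d + 1) / (1 - c) \<le> real n" for n
  proof -
    define x where "x = real n / (real d + 1)"
    \<comment> \<open>The extra \<open>d + 1\<close> ensures \<open>d < s\<close>. Because
      \<open>d * (d + 1)\<close> is even, \<open>s * d\<close> has the parity of
      \<open>d * n\<close>, as the circulant base graph requires.\<close>
    define s where "s = d + 1 + n mod (d + 1)"
    define q where "q = n div (d + 1) - 1"
    define k where "k = nat \<lceil>c * x\<rceil>"
    have n0: "real n > 0" using n by simp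
    have x0: "x > 0" using n0 by (simp add: x_def)
    have nx: "real n = x * (real d + 1)" by (simp add: x_def)
    have q1: "1 \<le> n div (d + 1)" using n by (simp add: div_greater_zero_iff Suc_leI)
    have "n = n mod (d + 1) + (n div (d + 1)) * (d + 1)" by (rule mod_div_mult_eq[symmetric])
    moreover have "n div (d + 1) = q + 1" using q1 by (simp add: q_def)
    ultimately have nq: "n = s + q * (d + 1)" by (simp add: s_def)
    have ds: "d < s" by (simp add: s_def)
    have "d * n = d * s + q * (d * (d + 1))" by (subst nq) (simp add: algebra_simps)
    then have es: "even (s * d)" using ev by (simp add: mult.commute)
    have "s \<le> 2 * (d + 1)" using mod_less_divisor[of "d + 1" n] by (simp add: s_def)
    then have "n \<le> (q + 2) * (d + 1)" using nq by (simp add: algebra_simps)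
    then have "real n \<le> real ((q + 2) * (d + 1))" by (simp only: of_nat_le_iff)
    then have "real n \<le> (real q + 2) * (real d + 1)" by (simp add: algebra_simps)
    then have "x \<le> real q + 2" unfolding x_def by (subst pos_divide_le_eq) simp_all
    then have qx: "x - 2 \<le> real q" by simp
    have k: "c * x \<le> real k" "real k \<le> c * x + 1"
      using x0 assms by (simp_all add: k_def)
    \<comment> \<open>Rounding gives \<open>q - k >= (1 - c) * x - 3\<close>; the threshold 6 makes
      this at least half of \<open>(1 - c) * x\<close>.\<close>
    have "6 \<le> (1 - c) * x"
      using n(2) assms by (simp add: x_def field_simps)
    then have x6: "6 \<le> x - c * x" by (simp add: left_diff_distrib)
    then have kq: "k \<le> q" using qx k(2) by linarith
    have qk: "real (q - k) = real q - real k" using kq by simp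
    have ck: "c * real n \<le> real k * (real d + 1)"
      using k(1) by (simp add: nx)
    have qn: "q \<le> n" unfolding nq by simp
    have \<beta>n: "\<beta> * real n = min c (1 - c) * x / 2" by (simp add: \<beta>_def x_def)
    have "min c (1 - c) * x \<le> c * x" "min c (1 - c) * x \<le> (1 - c) * x" "0 \<le> c * x"
      using x0 assms by (auto intro: mult_right_mono)
    then have \<beta>k: "\<beta> * real n \<le> real k" "\<beta> * real n \<le> real (q - k)"
      unfolding \<beta>n qk using k qx x6 unfolding left_diff_distrib by linarith+
    have "real d * real n / 2 - real d * (real d + 1) = (x - 2) * real P"
      unfolding P nx by (simp add: algebra_simps)
    also have "\<dots> \<le> real q * real P" using qx by (intro mult_right_mono) auto
    finally have "real d * real n / 2 - real d * (real d + 1) \<le> real q * real P" .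
    moreover have "real k * (real d * (real d - 1) / 2) \<le> (c * x + 1) * (real d * (real d - 1) / 2)"
      using k d0 by (intro mult_right_mono) auto
    moreover have "growth d c * real n = real d * real n / 2 - c * x * (real d * (real d - 1) / 2)"
      unfolding growth_def nx by (simp add: field_simps)
    moreover have "real (k * d + (q - k) * P) = real q * real P - real k * (real d * (real d - 1) / 2)"
      by (simp add: qk P field_simps)
    ultimately have expo: "growth d c * real n - W \<le> real (k * d + (q - k) * P)"
      by (simp add: W_def distrib_right)
    have "b ^ n * real n powr (growth d c * real n - W) \<le> b ^ n * real n powr real (k * d + (q - k) * P)"
      using n expo \<beta> by (intro mult_left_mono powr_mono) (auto simp: b_def)
    also have "\<dots> = (real n ^ k * (\<beta> / exp 1) ^ n) ^ d * (real n ^ (q - k) * (\<beta> / exp 1) ^ n) ^ P"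
    proof -
      have "real n powr real (k * d + (q - k) * P) = (real n ^ k) ^ d * (real n ^ (q - k)) ^ P"
        using n0 by (simp only: powr_realpow power_add power_mult)
      moreover have "b ^ n = ((\<beta> / exp 1) ^ n) ^ d * ((\<beta> / exp 1) ^ n) ^ P"
        unfolding b_def by (simp only: power_add power_mult_distrib flip: power_mult) (simp only: mult.commute)
      ultimately show ?thesis by (simp only: power_mult_distrib ac_simps)
    qed
    also have "\<dots> \<le> fact k ^ d * fact (q - k) ^ P"
      using \<beta> \<beta>1 \<beta>k kq qn by (intro mult_mono power_mono fact_ge_linear) auto
    also have "\<dots> = real (fact k ^ d * fact (q - k) ^ P)" by simp
    also have "\<dots> \<le> real (card (G_dc d c n))"
      using card_G_dc_ge[OF ds es kq nq ck] unfolding P_def by (rule of_nat_mono)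
    finally show ?thesis .
  qed
  have "\<forall>\<^sub>F n in sequentially. d + 1 \<le> n" by (rule eventually_ge_at_top)
  moreover have "\<forall>\<^sub>F n in sequentially. 6 * (real d + 1) / (1 - c) \<le> real n"
    using filterlim_real_sequentially by (simp add: filterlim_at_top)
  ultimately have "\<forall>\<^sub>F n in sequentially. even (d * n) \<longrightarrow>
      b ^ n * real n powr (growth d c * real n - W) \<le> real (card (G_dc d c n))"
    by eventually_elim (use bound in blast)
  moreover have "b > 0" using \<beta> by (simp add: b_def)
  moreover have "W \<ge> 0" using d0 by (simp add: W_def)
  ultimately show ?thesis by blast
qed

theorem theorem5:
  fixes d :: nat and c :: real and \<epsilon> :: "nat \<Rightarrow> real"
  assumes "0 < c" and "c < 1"
    and "(\<exists>e>0. \<forall>n. \<epsilon> n = e) \<or>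
         ((\<forall>n. \<epsilon> n > 0) \<and> \<epsilon> \<longlonglongrightarrow> 0 \<and>
          filterlim (\<lambda>n. \<epsilon> n * ln (real n)) at_top sequentially)"
  shows "(\<lambda>n. real (card {E \<in> G_dc d c n. real (card (bad_nodes d n E)) > \<epsilon> n * real n})
              / real (card (G_dc d c n))) \<longlonglongrightarrow> 0"
proof -
  define \<gamma> where "\<gamma> = 1 / (2 * (real d + 1)^2)"
  define A where "A = 2 ^ (d * d) * exp (1 :: real)"
  define r where "r n = real (card {E \<in> G_dc d c n. real (card (bad_nodes d n E)) > \<epsilon> n * real n})
              / real (card (G_dc d c n))" for n
  have \<gamma>: "\<gamma> > 0" and A: "A > 0" by (simp_all add: \<gamma>_def A_def)
  have ln_lim: "filterlim (\<lambda>n. ln (real n)) at_top sequentially"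
    by (rule filterlim_compose[OF ln_at_top filterlim_real_sequentially])
  \<comment> \<open>A constant \<open>\<epsilon>\<close> satisfies the same growth condition, so the
    two cases merge.\<close>
  have eps: "filterlim (\<lambda>n. \<epsilon> n * ln (real n)) at_top sequentially"
    using assms(3)
  proof (elim disjE exE conjE)
    fix e assume "e > 0" "\<forall>n. \<epsilon> n = e"
    then show ?thesis
      using filterlim_tendsto_pos_mult_at_top[OF tendsto_const _ ln_lim] by simp
  qed
  obtain b W where b: "b > 0" and W: "W \<ge> 0" and lower: "\<forall>\<^sub>F n in sequentially. even (d * n) \<longrightarrow>
    b ^ n * real n powr (growth d c * real n - W) \<le> real (card (G_dc d c n))"
    using card_G_dc_lower_bound[OF assms(1,2)] by blast
  \<comment> \<open>This threshold lets the saving from bad nodes outweigh the exponential factors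
    \<open>A / b\<close> and the loss \<open>W * ln n <= W * n\<close>, with \<open>- n\<close> left
    over in the exponent.\<close>
  have "\<forall>\<^sub>F n in sequentially. (ln (A / b) + W + 1) / \<gamma> \<le> \<epsilon> n * ln (real n)"
    using eps by (simp add: filterlim_at_top)
  then have upper: "\<forall>\<^sub>F n in sequentially. r n \<le> exp (- real n)"
    using lower eventually_gt_at_top[of 0]
  proof eventually_elim
    case (elim n)
    show ?case
    \<comment> \<open>For an empty set, as when \<open>d * n\<close> is odd, the quotient is 0 by
      the convention for division by zero. Otherwise any member gives the parity needed for the
      lower bound.\<close>
    proof (cases "G_dc d c n = {}")
      case True
      then show ?thesis by (simp add: r_def)
    next
      case False
      then obtain E where "E \<in> graphs n" "regular d n E" by (auto simp: G_dc_def)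
      then have "even (d * n)" by (metis handshake dvd_triv_left)
      let ?g = "growth d c * real n"
      have low: "b ^ n * real n powr (?g - W) \<le> real (card (G_dc d c n))"
        using elim \<open>even (d * n)\<close> by blast
      have pos: "0 < b ^ n * real n powr (?g - W)" using b elim by simp
      have "r n \<le> (A ^ n * real n powr (?g - \<gamma> * \<epsilon> n * real n)) / (b ^ n * real n powr (?g - W))"
        unfolding r_def
      proof (rule frac_le)
        show "real (card {E \<in> G_dc d c n. real (card (bad_nodes d n E)) > \<epsilon> n * real n})
            \<le> A ^ n * real n powr (?g - \<gamma> * \<epsilon> n * real n)"
          using card_many_bad_le[of n d c "\<epsilon> n"] elim by (simp add: A_def \<gamma>_def)
      qed (use low pos A in auto)
      also have "\<dots> = exp (real n * ln (A / b) + (W - \<gamma> * \<epsilon> n * real n) * ln (real n))"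
        using elim A b
        by (simp add: powr_def ln_div exp_diff exp_add exp_of_nat_mult right_diff_distrib left_diff_distrib power_divide)
      also have "\<dots> \<le> exp (- real n)"
      proof -
        have "ln (A / b) + W + 1 \<le> \<gamma> * (\<epsilon> n * ln (real n))"
          using elim \<gamma> by (simp add: divide_le_eq mult.commute)
        then have "real n * (ln (A / b) + W + 1) \<le> real n * (\<gamma> * (\<epsilon> n * ln (real n)))"
          by (intro mult_left_mono) auto
        moreover have "W * ln (real n) \<le> W * real n"
          using W ln_bound[of "real n"] \<open>0 < n\<close> by (intro mult_left_mono) simp_all
        ultimately show ?thesis by (simp add: algebra_simps)
      qed
      finally show ?thesis .
    qed
  qed
  have nonneg: "\<forall>\<^sub>F n in sequentially. 0 \<le> r n" by (simp add: r_def)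
  have lim: "(\<lambda>n. exp (- real n)) \<longlonglongrightarrow> 0"
    by (intro filterlim_compose[OF exp_at_bot] filterlim_compose[OF filterlim_uminus_at_bot_at_top]
        filterlim_real_sequentially)
  have "r \<longlonglongrightarrow> 0"
    by (rule tendsto_sandwich[OF nonneg upper tendsto_const lim])
  then show ?thesis by (simp add: r_def[abs_def])
qed

end
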